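(* Let $\mathbb{K}=\mathbb{R}$ or $\mathbb{K}=\mathbb{C}$, let $(H,\langle\cdot,\cdot\rangle)$ be an inner product space over $\mathbb{K}$ and let $e\in H$ with $\|e\|=1$. Let $\varphi,\gamma,\Phi,\Gamma\in\mathbb{K}$ and $x,y\in H$ be such that $$\operatorname{Re}\langle \Phi e-x,\,x-\varphi e\rangle\ge 0\quad\text{and}\quad \operatorname{Re}\langle \Gamma e-y,\,y-\gamma e\rangle\ge 0,$$ or, equivalently, $$\left\|x-\frac{\varphi+\Phi}{2}e\right\|\le\frac12|\Phi-\varphi|\quad\text{and}\quad \left\|y-\frac{\gamma+\Gamma}{2}e\right\|\le\frac12|\Gamma-\gamma|.$$ Then $$\left|\langle x,y\rangle-\langle x,e\rangle\langle e,y\rangle\right|\le\frac14\,|\Phi-\varphi|\cdot|\Gamma-\gamma|-\left[\operatorname{Re}\langle \Phi e-x,\,x-\varphi e\rangle\right]^{\frac12}\left[\operatorname{Re}\langle \Gamma e-y,\,y-\gamma e\rangle\right]^{\frac12}.$$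
   Context: Inner products are linear in the first argument and conjugate-linear in the second; $\|x\|=\langle x,x\rangle^{1/2}$. *)

theory Defs
  imports "HOL-Analysis.Inner_Product"
begin

text \<open>
  Real inner product spaces are the types of class \<^class>\<open>real_inner\<close>. A complex inner
  product space is also a real one, with the same norm, via the real part of its inner product.
  The axiom \<open>inner_eq_Re_cinner\<close> records this, so that positive definiteness of \<open>cinner\<close> and
  the meaning of \<^const>\<open>norm\<close> are inherited from \<^class>\<open>real_inner\<close>;
  see \<open>cinner_same\<close>, \<open>cinner_eq_zero_iff\<close> and \<open>norm_eq_sqrt_cinner\<close> below.
  The inner product is linear in its first argument.
\<close>

class complex_inner = real_inner +
  fixes scaleC :: "complex \<Rightarrow> 'a \<Rightarrow> 'a" (infixr "*\<^sub>C" 75)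
    and cinner :: "'a \<Rightarrow> 'a \<Rightarrow> complex"
  assumes scaleC_add_right: "a *\<^sub>C (x + y) = a *\<^sub>C x + a *\<^sub>C y"
    and scaleC_add_left: "(a + b) *\<^sub>C x = a *\<^sub>C x + b *\<^sub>C x"
    and scaleC_scaleC: "a *\<^sub>C (b *\<^sub>C x) = (a * b) *\<^sub>C x"
    and scaleR_scaleC: "r *\<^sub>R x = complex_of_real r *\<^sub>C x"
    and cinner_add_left: "cinner (x + y) z = cinner x z + cinner y z"
    and cinner_scaleC_left: "cinner (a *\<^sub>C x) y = a * cinner x y"
    and cinner_commute: "cinner y x = cnj (cinner x y)"
    and inner_eq_Re_cinner: "inner x y = Re (cinner x y)"

lemma scaleC_one: "1 *\<^sub>C (x :: 'a::complex_inner) = x"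
  using scaleR_scaleC[of 1 x] by simp

lemma cinner_add_right: "cinner z (x + y) = cinner z x + cinner z (y :: 'a::complex_inner)"
  by (metis cinner_add_left cinner_commute complex_cnj_add)

lemma cinner_scaleC_right: "cinner x (a *\<^sub>C y) = cnj a * cinner x (y :: 'a::complex_inner)"
  by (metis cinner_commute cinner_scaleC_left complex_cnj_mult)

lemma cinner_same: "cinner x x = complex_of_real ((norm (x :: 'a::complex_inner))\<^sup>2)"
proof -
  have "Im (cinner x x) = 0"
    using cinner_commute[of x x] by (metis Im_complex_of_real Reals_cases Reals_cnj_iff)
  then show ?thesis
    by (simp add: complex_eq_iff power2_norm_eq_inner inner_eq_Re_cinner del: of_real_power)
qed

lemma cinner_eq_zero_iff: "cinner x x = 0 \<longleftrightarrow> (x :: 'a::complex_inner) = 0"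
  by (simp add: cinner_same)

lemma norm_eq_sqrt_cinner: "norm (x :: 'a::complex_inner) = sqrt (Re (cinner x x))"
  by (simp add: norm_eq_sqrt_inner inner_eq_Re_cinner)

instantiation complex :: complex_inner
begin

definition scaleC_complex :: "complex \<Rightarrow> complex \<Rightarrow> complex"
  where "scaleC_complex a x = a * x"

definition cinner_complex :: "complex \<Rightarrow> complex \<Rightarrow> complex"
  where "cinner_complex x y = x * cnj y"

instance
  by standard
    (simp_all add: scaleC_complex_def cinner_complex_def inner_complex_def scaleR_conv_of_real
      algebra_simps)

end

end

theory Submission
  imports Defs
begin

text \<open>
  Write \<open>p = \<phi> e\<close> and \<open>q = \<Phi> e\<close>. Completing the square turns
  \<open>Re \<langle>q - x, x - p\<rangle>\<close> into \<open>(\<parallel>q - p\<parallel> / 2)\<^sup>2 - \<parallel>x - (p + q) / 2\<parallel>\<^sup>2\<close>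
  (\<open>inner_endpoints_eq\<close>), so it is nonnegative exactly when \<open>x\<close> lies in the ball with diameter
  from \<open>p\<close> to \<open>q\<close>. This is the stated equivalence of hypotheses.

  For the inequality, let \<open>x' = x - \<langle>x, e\<rangle> e\<close> and \<open>y' = y - \<langle>y, e\<rangle> e\<close> be the components
  orthogonal to \<open>e\<close>. The left-hand side is \<open>\<bar>\<langle>x', y'\<rangle>\<bar>\<close>, at most \<open>\<parallel>x'\<parallel> \<parallel>y'\<parallel>\<close> by
  Cauchy-Schwarz. The centre of the ball is a multiple of \<open>e\<close>, so the distance from \<open>x\<close> to it is at
  least \<open>\<parallel>x'\<parallel>\<close>; the identity above then yields
  \<open>\<parallel>x'\<parallel>\<^sup>2 + Re \<langle>q - x, x - p\<rangle> \<le> (\<bar>\<Phi> - \<phi>\<bar> / 2)\<^sup>2\<close>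
  (\<open>orthogonal_part_bound\<close>), and likewise for \<open>y\<close>. Multiplying the two estimates and applying
  Cauchy-Schwarz in the plane, in the form \<open>s t + \<surd>A \<surd>B \<le> \<surd>(s\<^sup>2 + A) \<surd>(t\<^sup>2 + B)\<close>, gives
  the claim (\<open>refined_product_bound\<close>).

  The geometric steps concern only the real part of the inner product. They are therefore proved for
  real inner product spaces with \<open>p\<close> and \<open>q\<close> arbitrary vectors and serve both scalar fields: over
  the complex numbers \<open>p\<close> and \<open>q\<close> need not lie on one real line through the origin.
\<close>

section \<open>Real inner product geometry\<close>

text \<open>With \<open>m\<close> the midpoint of \<open>p\<close> and \<open>q\<close>, and \<open>d = (q - p) / 2\<close>, the factors are
  \<open>d - (x - m)\<close> and \<open>d + (x - m)\<close>: a difference of squares.\<close>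

lemma inner_endpoints_eq:
  fixes p q x :: "'a::real_inner"
  shows "inner (q - x) (x - p) = (norm (q - p) / 2)\<^sup>2 - (norm (x - (1 / 2) *\<^sub>R (p + q)))\<^sup>2"
  by (simp add: power_divide power2_norm_eq_inner inner_simps inner_commute field_simps)

lemma inner_endpoints_nonneg_iff:
  fixes p q x :: "'a::real_inner"
  shows "inner (q - x) (x - p) \<ge> 0 \<longleftrightarrow> norm (x - (1 / 2) *\<^sub>R (p + q)) \<le> norm (q - p) / 2"
  unfolding inner_endpoints_eq by (simp add: abs_le_square_iff[symmetric])

text \<open>Removing from \<open>x\<close> a component \<open>u\<close> orthogonal to \<open>p\<close>, \<open>q\<close> and the rest \<open>w\<close> raises
  \<open>inner (q - x) (x - p)\<close> by exactly \<open>\<parallel>u\<parallel>\<^sup>2\<close>, and the value reached at \<open>w\<close> is still at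
  most the squared radius of the ball.\<close>

lemma orthogonal_part_bound:
  fixes p q u w :: "'a::real_inner"
  assumes "inner u p = 0" "inner u q = 0" "inner u w = 0"
  shows "(norm u)\<^sup>2 + inner (q - (u + w)) ((u + w) - p) \<le> (norm (q - p) / 2)\<^sup>2"
proof -
  have "(norm u)\<^sup>2 + inner (q - (u + w)) ((u + w) - p) = inner (q - w) (w - p)"
    using assms by (simp add: power2_norm_eq_inner inner_simps inner_commute)
  also have "\<dots> \<le> (norm (q - p) / 2)\<^sup>2"
    unfolding inner_endpoints_eq by simp
  finally show ?thesis .
qed

text \<open>Cauchy-Schwarz in the plane for \<open>(s, \<surd>A)\<close> and \<open>(t, \<surd>B)\<close>, which have norms at most
  \<open>D\<close> and \<open>E\<close>.\<close>

lemma refined_product_bound: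
  fixes s t A B D E :: real
  assumes "s\<^sup>2 + A \<le> D\<^sup>2" "t\<^sup>2 + B \<le> E\<^sup>2" "A \<ge> 0" "B \<ge> 0" "D \<ge> 0" "E \<ge> 0"
  shows "s * t + sqrt A * sqrt B \<le> D * E"
proof (rule power2_le_imp_le)
  have "(s * t + sqrt A * sqrt B)\<^sup>2 + (s * sqrt B - t * sqrt A)\<^sup>2
      = (s\<^sup>2 + (sqrt A)\<^sup>2) * (t\<^sup>2 + (sqrt B)\<^sup>2)"
    by (simp add: power2_eq_square algebra_simps)
  also have "\<dots> \<le> D\<^sup>2 * E\<^sup>2"
    using assms by (intro mult_mono) auto
  finally show "(s * t + sqrt A * sqrt B)\<^sup>2 \<le> (D * E)\<^sup>2"
    using zero_le_power2[of "s * sqrt B - t * sqrt A"]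
    unfolding power_mult_distrib by linarith
qed (use assms in simp)

section \<open>Complex inner products\<close>

lemma cinner_diff_left: "cinner (x - y) z = cinner x z - cinner (y :: 'a::complex_inner) z"
  using cinner_add_left[of "x - y" y z] by simp

lemma cinner_diff_right: "cinner z (x - y) = cinner z x - cinner z (y :: 'a::complex_inner)"
  using cinner_add_right[of z "x - y" y] by simp

lemma scaleC_diff_left: "(a - b) *\<^sub>C x = a *\<^sub>C x - b *\<^sub>C (x :: 'a::complex_inner)"
  using scaleC_add_left[of "a - b" b x] by simp

lemma norm_scaleC: "norm (a *\<^sub>C x) = cmod a * norm (x :: 'a::complex_inner)"
proof (rule power2_eq_imp_eq)
  have "complex_of_real ((norm (a *\<^sub>C x))\<^sup>2) = (a * cnj a) * cinner x x"
    by (simp only: cinner_same[symmetric] cinner_scaleC_left cinner_scaleC_right mult_ac)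
  also have "\<dots> = complex_of_real ((cmod a * norm x)\<^sup>2)"
    by (simp add: complex_norm_square[symmetric] cinner_same power_mult_distrib)
  finally show "(norm (a *\<^sub>C x))\<^sup>2 = (cmod a * norm x)\<^sup>2"
    using of_real_eq_iff by blast
qed simp_all

text \<open>Multiplying \<open>x\<close> by a suitable phase makes \<open>cinner x y\<close> real and nonnegative, and
  Cauchy-Schwarz for the real part applies.\<close>

lemma cmod_cinner_le: "cmod (cinner x y) \<le> norm x * norm (y :: 'a::complex_inner)"
proof (cases "cinner x y = 0")
  case False
  define a where "a = cnj (sgn (cinner x y))"
  have a: "cmod a = 1"
    using False by (simp add: a_def norm_sgn)
  have "a * cinner x y = complex_of_real (cmod (cinner x y))"
    using False
    by (simp add: a_def sgn_eq mult.commute[of "cnj _"] complex_norm_square[symmetric]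
        power2_eq_square)
  then have "cmod (cinner x y) = inner (a *\<^sub>C x) y"
    by (simp add: inner_eq_Re_cinner cinner_scaleC_left)
  also have "\<dots> \<le> norm (a *\<^sub>C x) * norm y"
    by (rule norm_cauchy_schwarz)
  finally show ?thesis
    by (simp add: norm_scaleC a)
qed simp

section \<open>The refined Gruess inequality over both fields\<close>

lemma real_nonneg_iff_ball:
  fixes e x :: "'a::real_inner" and \<phi> \<Phi> :: real
  assumes "norm e = 1"
  shows "inner (\<Phi> *\<^sub>R e - x) (x - \<phi> *\<^sub>R e) \<ge> 0
    \<longleftrightarrow> norm (x - ((\<phi> + \<Phi>) / 2) *\<^sub>R e) \<le> 1 / 2 * \<bar>\<Phi> - \<phi>\<bar>"
  using assms
  by (simp add: inner_endpoints_nonneg_iff flip: scaleR_add_left scaleR_diff_left)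

lemma complex_nonneg_iff_ball:
  fixes e x :: "'a::complex_inner" and \<phi> \<Phi> :: complex
  assumes "norm e = 1"
  shows "Re (cinner (\<Phi> *\<^sub>C e - x) (x - \<phi> *\<^sub>C e)) \<ge> 0
    \<longleftrightarrow> norm (x - ((\<phi> + \<Phi>) / 2) *\<^sub>C e) \<le> 1 / 2 * cmod (\<Phi> - \<phi>)"
  using assms
  by (simp add: inner_endpoints_nonneg_iff norm_scaleC scaleR_scaleC scaleC_scaleC
      flip: inner_eq_Re_cinner scaleC_add_left scaleC_diff_left)

lemma real_orthogonal_part_bound:
  fixes e x :: "'a::real_inner" and \<phi> \<Phi> :: real
  assumes e: "norm e = 1"
  shows "(norm (x - inner x e *\<^sub>R e))\<^sup>2 + inner (\<Phi> *\<^sub>R e - x) (x - \<phi> *\<^sub>R e)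
    \<le> (\<bar>\<Phi> - \<phi>\<bar> / 2)\<^sup>2"
proof -
  let ?u = "x - inner x e *\<^sub>R e"
  have "inner e e = 1"
    using e by (simp add: dot_square_norm)
  then have "inner ?u (c *\<^sub>R e) = 0" for c
    by (simp add: inner_simps)
  from orthogonal_part_bound[OF this this this, of \<Phi> "inner x e" \<phi>] e show ?thesis
    by (simp flip: scaleR_diff_left)
qed

lemma complex_orthogonal_part_bound:
  fixes e x :: "'a::complex_inner" and \<phi> \<Phi> :: complex
  assumes e: "norm e = 1"
  shows "(norm (x - cinner x e *\<^sub>C e))\<^sup>2 + Re (cinner (\<Phi> *\<^sub>C e - x) (x - \<phi> *\<^sub>C e))
    \<le> (cmod (\<Phi> - \<phi>) / 2)\<^sup>2"
proof -
  let ?u = "x - cinner x e *\<^sub>C e"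
  have "cinner e e = 1"
    using e by (simp add: cinner_same)
  then have "inner ?u (c *\<^sub>C e) = 0" for c
    by (simp add: inner_eq_Re_cinner cinner_diff_left cinner_scaleC_left cinner_scaleC_right)
  from orthogonal_part_bound[OF this this this, of \<Phi> "cinner x e" \<phi>] e show ?thesis
    by (simp add: norm_scaleC flip: scaleC_diff_left inner_eq_Re_cinner)
qed

lemma real_refined_gruess:
  fixes e x y :: "'a::real_inner" and \<phi> \<gamma> \<Phi> \<Gamma> :: real
  assumes e: "norm e = 1"
    and x: "inner (\<Phi> *\<^sub>R e - x) (x - \<phi> *\<^sub>R e) \<ge> 0"
    and y: "inner (\<Gamma> *\<^sub>R e - y) (y - \<gamma> *\<^sub>R e) \<ge> 0"
  shows "\<bar>inner x y - inner x e * inner e y\<bar>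
    \<le> 1 / 4 * \<bar>\<Phi> - \<phi>\<bar> * \<bar>\<Gamma> - \<gamma>\<bar>
      - sqrt (inner (\<Phi> *\<^sub>R e - x) (x - \<phi> *\<^sub>R e))
        * sqrt (inner (\<Gamma> *\<^sub>R e - y) (y - \<gamma> *\<^sub>R e))"
proof -
  let ?u = "x - inner x e *\<^sub>R e" and ?v = "y - inner y e *\<^sub>R e"
  have "inner e e = 1"
    using e by (simp add: dot_square_norm)
  then have "inner x y - inner x e * inner e y = inner ?u ?v"
    by (simp add: inner_simps inner_commute)
  then have "\<bar>inner x y - inner x e * inner e y\<bar> \<le> norm ?u * norm ?v"
    using Cauchy_Schwarz_ineq2[of ?u ?v] by simp
  with refined_product_bound[OF real_orthogonal_part_bound[OF e] real_orthogonal_part_bound[OF e] x y]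
  show ?thesis by simp
qed

lemma complex_refined_gruess:
  fixes e x y :: "'a::complex_inner" and \<phi> \<gamma> \<Phi> \<Gamma> :: complex
  assumes e: "norm e = 1"
    and x: "Re (cinner (\<Phi> *\<^sub>C e - x) (x - \<phi> *\<^sub>C e)) \<ge> 0"
    and y: "Re (cinner (\<Gamma> *\<^sub>C e - y) (y - \<gamma> *\<^sub>C e)) \<ge> 0"
  shows "cmod (cinner x y - cinner x e * cinner e y)
    \<le> 1 / 4 * cmod (\<Phi> - \<phi>) * cmod (\<Gamma> - \<gamma>)
      - sqrt (Re (cinner (\<Phi> *\<^sub>C e - x) (x - \<phi> *\<^sub>C e)))
        * sqrt (Re (cinner (\<Gamma> *\<^sub>C e - y) (y - \<gamma> *\<^sub>C e)))"
proof -
  let ?u = "x - cinner x e *\<^sub>C e" and ?v = "y - cinner y e *\<^sub>C e"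
  have "cinner e e = 1"
    using e by (simp add: cinner_same)
  then have "cinner x y - cinner x e * cinner e y = cinner ?u ?v"
    by (simp add: cinner_diff_left cinner_diff_right cinner_scaleC_left cinner_scaleC_right
        cinner_commute[of y e])
  then have "cmod (cinner x y - cinner x e * cinner e y) \<le> norm ?u * norm ?v"
    using cmod_cinner_le[of ?u ?v] by simp
  with refined_product_bound[OF complex_orthogonal_part_bound[OF e]
      complex_orthogonal_part_bound[OF e] x y]
  show ?thesis by simp
qed

theorem theorem3:
  shows
    "(\<forall>(e :: 'a::real_inner) (x :: 'a) (y :: 'a) (\<phi> :: real) (\<gamma> :: real) (\<Phi> :: real) (\<Gamma> :: real).
        norm e = 1 \<longrightarrow>
          (inner (\<Phi> *\<^sub>R e - x) (x - \<phi> *\<^sub>R e) \<ge> 0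
             \<longleftrightarrow> norm (x - ((\<phi> + \<Phi>) / 2) *\<^sub>R e) \<le> 1 / 2 * \<bar>\<Phi> - \<phi>\<bar>) \<and>
          (inner (\<Gamma> *\<^sub>R e - y) (y - \<gamma> *\<^sub>R e) \<ge> 0
             \<longleftrightarrow> norm (y - ((\<gamma> + \<Gamma>) / 2) *\<^sub>R e) \<le> 1 / 2 * \<bar>\<Gamma> - \<gamma>\<bar>) \<and>
          (inner (\<Phi> *\<^sub>R e - x) (x - \<phi> *\<^sub>R e) \<ge> 0 \<and>
           inner (\<Gamma> *\<^sub>R e - y) (y - \<gamma> *\<^sub>R e) \<ge> 0 \<longrightarrow>
             \<bar>inner x y - inner x e * inner e y\<bar>
               \<le> 1 / 4 * \<bar>\<Phi> - \<phi>\<bar> * \<bar>\<Gamma> - \<gamma>\<bar>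
                  - sqrt (inner (\<Phi> *\<^sub>R e - x) (x - \<phi> *\<^sub>R e))
                    * sqrt (inner (\<Gamma> *\<^sub>R e - y) (y - \<gamma> *\<^sub>R e))))
     \<and>
     (\<forall>(e :: 'b::complex_inner) (x :: 'b) (y :: 'b)
        (\<phi> :: complex) (\<gamma> :: complex) (\<Phi> :: complex) (\<Gamma> :: complex).
        norm e = 1 \<longrightarrow>
          (Re (cinner (\<Phi> *\<^sub>C e - x) (x - \<phi> *\<^sub>C e)) \<ge> 0
             \<longleftrightarrow> norm (x - ((\<phi> + \<Phi>) / 2) *\<^sub>C e) \<le> 1 / 2 * cmod (\<Phi> - \<phi>)) \<and>
          (Re (cinner (\<Gamma> *\<^sub>C e - y) (y - \<gamma> *\<^sub>C e)) \<ge> 0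
             \<longleftrightarrow> norm (y - ((\<gamma> + \<Gamma>) / 2) *\<^sub>C e) \<le> 1 / 2 * cmod (\<Gamma> - \<gamma>)) \<and>
          (Re (cinner (\<Phi> *\<^sub>C e - x) (x - \<phi> *\<^sub>C e)) \<ge> 0 \<and>
           Re (cinner (\<Gamma> *\<^sub>C e - y) (y - \<gamma> *\<^sub>C e)) \<ge> 0 \<longrightarrow>
             cmod (cinner x y - cinner x e * cinner e y)
               \<le> 1 / 4 * cmod (\<Phi> - \<phi>) * cmod (\<Gamma> - \<gamma>)
                  - sqrt (Re (cinner (\<Phi> *\<^sub>C e - x) (x - \<phi> *\<^sub>C e)))
                    * sqrt (Re (cinner (\<Gamma> *\<^sub>C e - y) (y - \<gamma> *\<^sub>C e)))))"
  by (intro conjI allI impI; (elim conjE)?;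
      rule real_nonneg_iff_ball complex_nonneg_iff_ball real_refined_gruess complex_refined_gruess;
      assumption)

end
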